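(* Let $(X,r)$ be a set-theoretic solution of the Yang--Baxter equation, and write $r(x,y)=(\sigma_x(y),\gamma_y(x))$ for all $x,y\in X$. Then there exists a unique monoid homomorphism $\lambda'\colon M(X,r)\to \operatorname{End}(A(X,r))$ such that $\lambda'(x)(y)=\sigma_x(y)$ for all $x,y\in X$, and there exists a unique monoid anti-homomorphism $\rho'\colon M(X,r)\to \operatorname{End}(A'(X,r))$ such that $\rho'(x)(y)=\gamma_x(y)$ for all $x,y\in X$. Furthermore, if $(X,r)$ is left non-degenerate, then $\operatorname{Im}(\lambda')\subseteq \operatorname{Aut}(A(X,r))$; and if $(X,r)$ is right non-degenerate, then $\operatorname{Im}(\rho')\subseteq\operatorname{Aut}(A'(X,r))$.
   Context: A set-theoretic solution of the Yang--Baxter equation (YBE) is a pair $(X,r)$ with $X$ a non-empty set (possibly infinite) and $r\colon X\times X\to X\times X$ a map (not necessarily bijective) such that $(r\times \mathrm{id}_X)\circ(\mathrm{id}_X\times r)\circ(r\times \mathrm{id}_X)=(\mathrm{id}_X\times r)\circ(r\times \mathrm{id}_X)\circ(\mathrm{id}_X\times r)$. Write $r(x,y)=(\sigma_x(y),\gamma_y(x))$. The solution is left non-degenerate if every $\sigma_x\colon X\to X$ is bijective, and right non-degenerate if every $\gamma_y\colon X\to X$ is bijective. The structure monoid is the monoid with presentation $M(X,r)=\langle X\mid x\circ y=\sigma_x(y)\circ\gamma_y(x),\ x,y\in X\rangle$ (operation $\circ$, identity $1$). The left derived structure monoid is $A(X,r)=\langle X\mid x+\sigma_x(y)=\sigma_x(y)+\sigma_{\sigma_x(y)}\gamma_y(x),\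 x,y\in X\rangle$ (operation $+$, not necessarily commutative, identity $0$). The right derived structure monoid is $A'(X,r)=\langle X\mid \gamma_y(x)\oplus y=\gamma_{\gamma_y(x)}\sigma_x(y)\oplus\gamma_y(x),\ x,y\in X\rangle$ (operation $\oplus$, not necessarily commutative, identity $0'$). Since the relations are homogeneous of degree $2$, $X$ is regarded as a subset of each of these monoids. $\operatorname{End}$ and $\operatorname{Aut}$ denote monoid endomorphisms and automorphisms, with composition as multiplication. *)

theory Defs
  imports "HOL-Algebra.Group" "HOL-Algebra.Bij"
begin

section \<open>Monoids given by a presentation\<close>

text \<open>The smallest congruence on the free monoid \<open>lists X\<close> containing the relations \<open>R\<close>.\<close>

inductive_set word_cong :: "'a set \<Rightarrow> ('a list \<times> 'a list) set \<Rightarrow> ('a list \<times> 'a list) set"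
  for X :: "'a set" and R :: "('a list \<times> 'a list) set"
where
  rel: "(u, v) \<in> R \<Longrightarrow> u \<in> lists X \<Longrightarrow> v \<in> lists X \<Longrightarrow> (u, v) \<in> word_cong X R"
| refl: "u \<in> lists X \<Longrightarrow> (u, u) \<in> word_cong X R"
| sym: "(u, v) \<in> word_cong X R \<Longrightarrow> (v, u) \<in> word_cong X R"
| trans: "(u, v) \<in> word_cong X R \<Longrightarrow> (v, w) \<in> word_cong X R \<Longrightarrow> (u, w) \<in> word_cong X R"
| append: "(u, v) \<in> word_cong X R \<Longrightarrow> (u', v') \<in> word_cong X R \<Longrightarrow>
    (u @ u', v @ v') \<in> word_cong X R"

definition word_class :: "'a set \<Rightarrow> ('a list \<times> 'a list) set \<Rightarrow> 'a list \<Rightarrow> 'a list set" where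
  "word_class X R w = word_cong X R `` {w}"

definition presented_monoid :: "'a set \<Rightarrow> ('a list \<times> 'a list) set \<Rightarrow> 'a list set monoid" where
  "presented_monoid X R =
    \<lparr>carrier = lists X // word_cong X R,
     mult = (\<lambda>P Q. \<Union>u\<in>P. \<Union>v\<in>Q. word_class X R (u @ v)),
     one = word_class X R []\<rparr>"

lemma word_cong_lists:
  "(u, v) \<in> word_cong X R \<Longrightarrow> u \<in> lists X \<and> v \<in> lists X"
  by (induction rule: word_cong.induct) auto

lemma equiv_word_cong: "equiv (lists X) (word_cong X R)"
proof (rule equivI)
  show "word_cong X R \<subseteq> lists X \<times> lists X"
    using word_cong_lists by fast
  show "refl_on (lists X) (word_cong X R)"
    by (rule refl_onI) (rule word_cong.refl)
  show "sym (word_cong X R)"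
    by (rule symI) (rule word_cong.sym)
  show "trans (word_cong X R)"
    by (rule transI) (rule word_cong.trans)
qed

lemma word_class_eq_iff:
  assumes "u \<in> lists X" "v \<in> lists X"
  shows "word_class X R u = word_class X R v \<longleftrightarrow> (u, v) \<in> word_cong X R"
  unfolding word_class_def using eq_equiv_class_iff[OF equiv_word_cong assms] .

lemma mult_word_class:
  assumes "u \<in> lists X" "v \<in> lists X"
  shows "word_class X R u \<otimes>\<^bsub>presented_monoid X R\<^esub> word_class X R v = word_class X R (u @ v)"
proof -
  have "word_class X R (u' @ v') = word_class X R (u @ v)"
    if "u' \<in> word_class X R u" "v' \<in> word_class X R v" for u' v'
  proof -
    have "(u' @ v', u @ v) \<in> word_cong X R"
      using that by (auto simp: word_class_def intro: word_cong.sym word_cong.append)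
    then show ?thesis
      using word_class_eq_iff[of "u' @ v'" X "u @ v" R] word_cong_lists[of "u' @ v'" "u @ v" X R]
      by blast
  qed
  moreover have "u \<in> word_class X R u" "v \<in> word_class X R v"
    using assms by (auto simp: word_class_def intro: word_cong.refl)
  ultimately show ?thesis
    unfolding presented_monoid_def monoid.simps by blast
qed

lemma carrier_presented_monoid:
  "carrier (presented_monoid X R) = word_class X R ` lists X"
  unfolding presented_monoid_def quotient_def word_class_def by (simp add: UNION_singleton_eq_range)

lemma monoid_presented_monoid: "Group.monoid (presented_monoid X R)"
proof -
  have one: "\<one>\<^bsub>presented_monoid X R\<^esub> = word_class X R []"
    by (simp add: presented_monoid_def)
  show ?thesis
  proof (rule monoidI, unfold carrier_presented_monoid one, goal_cases)
    case (1 x y)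
    then obtain u v where "u \<in> lists X" "v \<in> lists X" "x = word_class X R u" "y = word_class X R v"
      by blast
    then show ?case using mult_word_class append_in_lists_conv by (metis imageI)
  next
    case 2
    show ?case by (rule imageI) simp
  next
    case (3 x y z)
    then obtain u v w where uvw: "u \<in> lists X" "v \<in> lists X" "w \<in> lists X"
      and "x = word_class X R u" "y = word_class X R v" "z = word_class X R w"
      by blast
    moreover have "u @ v \<in> lists X" "v @ w \<in> lists X"
      using uvw by (simp_all only: append_in_lists_conv simp_thms)
    ultimately show ?case by (simp only: mult_word_class append_assoc)
  next
    case (4 x)
    then obtain u where "u \<in> lists X" "x = word_class X R u" by blast
    then show ?case by (simp only: mult_word_class lists.Nil append_Nil)
  next
    case (5 x)
    then obtain u where "u \<in> lists X" "x = word_class X R u" by blast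
    then show ?case by (simp only: mult_word_class lists.Nil append_Nil2)
  qed
qed

text \<open>If all relations are between words of length two, the generators embed.\<close>

lemma inj_on_generators:
  assumes "\<And>u v. (u, v) \<in> R \<Longrightarrow> length u = 2 \<and> length v = 2"
  shows "inj_on (\<lambda>x. word_class X R [x]) X"
proof -
  have *: "length u = length v \<and> (length u < 2 \<longrightarrow> u = v)" if "(u, v) \<in> word_cong X R" for u v
    using that
  proof (induction rule: word_cong.induct)
    case (rel u v)
    then show ?case using assms[of u v] by linarith
  next
    case (trans u v w)
    then show ?case by metis
  next
    case (append u v u' v')
    then show ?case by (metis add_lessD1 add.commute length_append)
  qed metis+
  show ?thesis
  proof (rule inj_onI)
    fix x y
    assume "x \<in> X" "y \<in> X" "word_class X R [x] = word_class X R [y]"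
    then have "([x], [y]) \<in> word_cong X R"
      using word_class_eq_iff[of "[x]" X "[y]" R] by simp
    from *[OF this] show "x = y" by simp
  qed
qed


section \<open>Monoid homomorphisms, anti-homomorphisms and endomorphisms\<close>

text \<open>
  The library's \<^const>\<open>hom\<close> does not require preservation of the identity. Homomorphisms are
  taken to be extensional, so that equality of functions is equality on the carrier.
\<close>

definition monoid_homs :: "('a, 'c) monoid_scheme \<Rightarrow> ('b, 'd) monoid_scheme \<Rightarrow> ('a \<Rightarrow> 'b) set" where
  "monoid_homs G H = {f \<in> hom G H \<inter> extensional (carrier G). f \<one>\<^bsub>G\<^esub> = \<one>\<^bsub>H\<^esub>}"

definition monoid_antihoms :: "('a, 'c) monoid_scheme \<Rightarrow> ('b, 'd) monoid_scheme \<Rightarrow> ('a \<Rightarrow> 'b) set" where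
  "monoid_antihoms G H =
    {f \<in> (carrier G \<rightarrow> carrier H) \<inter> extensional (carrier G).
      (\<forall>x\<in>carrier G. \<forall>y\<in>carrier G. f (x \<otimes>\<^bsub>G\<^esub> y) = f y \<otimes>\<^bsub>H\<^esub> f x) \<and> f \<one>\<^bsub>G\<^esub> = \<one>\<^bsub>H\<^esub>}"

text \<open>
  Multiplication is composition, \<open>f \<otimes> g = f \<circ> g\<close>. The automorphisms are the library's
  \<^const>\<open>auto\<close>: extensional bijective elements of \<^const>\<open>hom\<close>, which preserve the identity
  automatically.
\<close>

definition End_monoid :: "('a, 'c) monoid_scheme \<Rightarrow> ('a \<Rightarrow> 'a) monoid" where
  "End_monoid G =
    \<lparr>carrier = monoid_homs G G,
     mult = compose (carrier G),
     one = (\<lambda>x\<in>carrier G. x)\<rparr>"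

lemma auto_eq_bijective_endomorphisms:
  assumes "Group.monoid G"
  shows "auto G = {f \<in> monoid_homs G G. bij_betw f (carrier G) (carrier G)}"
proof -
  interpret Group.monoid G by fact
  have "f \<one>\<^bsub>G\<^esub> = \<one>\<^bsub>G\<^esub>" if f: "f \<in> hom G G" and b: "bij_betw f (carrier G) (carrier G)" for f
  proof -
    obtain e where e: "e \<in> carrier G" "f e = \<one>\<^bsub>G\<^esub>"
      using b one_closed by (metis bij_betw_imp_surj_on imageE)
    have "f \<one>\<^bsub>G\<^esub> = f \<one>\<^bsub>G\<^esub> \<otimes>\<^bsub>G\<^esub> f e"
      using e hom_in_carrier[OF f one_closed] by simp
    also have "\<dots> = f e"
      using hom_mult[OF f one_closed e(1)] e(1) by simp
    finally show ?thesis using e by simp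
  qed
  then show ?thesis
    by (auto simp: auto_def Bij_def monoid_homs_def)
qed


section \<open>Set-theoretic solutions of the Yang--Baxter equation\<close>

definition sigma :: "('a \<times> 'a \<Rightarrow> 'a \<times> 'a) \<Rightarrow> 'a \<Rightarrow> 'a \<Rightarrow> 'a" where
  "sigma r x y = fst (r (x, y))"

text \<open>The subscript comes first: \<open>gamma r y x\<close> is \<open>\<gamma>\<^sub>y(x)\<close>, so \<open>r (x, y) = (sigma r x y, gamma r y x)\<close>.\<close>

definition gamma :: "('a \<times> 'a \<Rightarrow> 'a \<times> 'a) \<Rightarrow> 'a \<Rightarrow> 'a \<Rightarrow> 'a" where
  "gamma r y x = snd (r (x, y))"

definition r_times_id :: "('a \<times> 'a \<Rightarrow> 'a \<times> 'a) \<Rightarrow> 'a \<times> 'a \<times> 'a \<Rightarrow> 'a \<times> 'a \<times> 'a" where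
  "r_times_id r = (\<lambda>(x, y, z). case r (x, y) of (a, b) \<Rightarrow> (a, b, z))"

definition id_times_r :: "('a \<times> 'a \<Rightarrow> 'a \<times> 'a) \<Rightarrow> 'a \<times> 'a \<times> 'a \<Rightarrow> 'a \<times> 'a \<times> 'a" where
  "id_times_r r = (\<lambda>(x, y, z). (x, r (y, z)))"

definition YBE_solution :: "'a set \<Rightarrow> ('a \<times> 'a \<Rightarrow> 'a \<times> 'a) \<Rightarrow> bool" where
  "YBE_solution X r \<longleftrightarrow>
    X \<noteq> {} \<and> r \<in> X \<times> X \<rightarrow> X \<times> X \<and>
    (\<forall>t \<in> X \<times> X \<times> X.
      (r_times_id r \<circ> id_times_r r \<circ> r_times_id r) t =
      (id_times_r r \<circ> r_times_id r \<circ> id_times_r r) t)"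

definition left_nondegenerate :: "'a set \<Rightarrow> ('a \<times> 'a \<Rightarrow> 'a \<times> 'a) \<Rightarrow> bool" where
  "left_nondegenerate X r \<longleftrightarrow> (\<forall>x\<in>X. bij_betw (sigma r x) X X)"

definition right_nondegenerate :: "'a set \<Rightarrow> ('a \<times> 'a \<Rightarrow> 'a \<times> 'a) \<Rightarrow> bool" where
  "right_nondegenerate X r \<longleftrightarrow> (\<forall>y\<in>X. bij_betw (gamma r y) X X)"


section \<open>The structure monoid and the derived structure monoids\<close>

definition M_rels :: "'a set \<Rightarrow> ('a \<times> 'a \<Rightarrow> 'a \<times> 'a) \<Rightarrow> ('a list \<times> 'a list) set" where
  "M_rels X r = {([x, y], [sigma r x y, gamma r y x]) | x y. x \<in> X \<and> y \<in> X}"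

definition A_rels :: "'a set \<Rightarrow> ('a \<times> 'a \<Rightarrow> 'a \<times> 'a) \<Rightarrow> ('a list \<times> 'a list) set" where
  "A_rels X r =
    {([x, sigma r x y], [sigma r x y, sigma r (sigma r x y) (gamma r y x)]) | x y. x \<in> X \<and> y \<in> X}"

definition A'_rels :: "'a set \<Rightarrow> ('a \<times> 'a \<Rightarrow> 'a \<times> 'a) \<Rightarrow> ('a list \<times> 'a list) set" where
  "A'_rels X r =
    {([gamma r y x, y], [gamma r (gamma r y x) (sigma r x y), gamma r y x]) | x y. x \<in> X \<and> y \<in> X}"

abbreviation structure_monoid :: "'a set \<Rightarrow> ('a \<times> 'a \<Rightarrow> 'a \<times> 'a) \<Rightarrow> 'a list set monoid" where
  "structure_monoid X r \<equiv> presented_monoid X (M_rels X r)"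

abbreviation left_derived_monoid :: "'a set \<Rightarrow> ('a \<times> 'a \<Rightarrow> 'a \<times> 'a) \<Rightarrow> 'a list set monoid" where
  "left_derived_monoid X r \<equiv> presented_monoid X (A_rels X r)"

abbreviation right_derived_monoid :: "'a set \<Rightarrow> ('a \<times> 'a \<Rightarrow> 'a \<times> 'a) \<Rightarrow> 'a list set monoid" where
  "right_derived_monoid X r \<equiv> presented_monoid X (A'_rels X r)"

text \<open>The images of the elements of \<open>X\<close> in the three monoids.\<close>

abbreviation M_gen :: "'a set \<Rightarrow> ('a \<times> 'a \<Rightarrow> 'a \<times> 'a) \<Rightarrow> 'a \<Rightarrow> 'a list set" where
  "M_gen X r x \<equiv> word_class X (M_rels X r) [x]"

abbreviation A_gen :: "'a set \<Rightarrow> ('a \<times> 'a \<Rightarrow> 'a \<times> 'a) \<Rightarrow> 'a \<Rightarrow> 'a list set" where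
  "A_gen X r x \<equiv> word_class X (A_rels X r) [x]"

abbreviation A'_gen :: "'a set \<Rightarrow> ('a \<times> 'a \<Rightarrow> 'a \<times> 'a) \<Rightarrow> 'a \<Rightarrow> 'a list set" where
  "A'_gen X r x \<equiv> word_class X (A'_rels X r) [x]"

lemma inj_on_gens:
  "inj_on (M_gen X r) X" "inj_on (A_gen X r) X" "inj_on (A'_gen X r) X"
  by (rule inj_on_generators; auto simp: M_rels_def A_rels_def A'_rels_def)+

definition is_lambda' ::
  "'a set \<Rightarrow> ('a \<times> 'a \<Rightarrow> 'a \<times> 'a) \<Rightarrow> ('a list set \<Rightarrow> 'a list set \<Rightarrow> 'a list set) \<Rightarrow> bool" where
  "is_lambda' X r l \<longleftrightarrow>
    l \<in> monoid_homs (structure_monoid X r) (End_monoid (left_derived_monoid X r)) \<and>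
    (\<forall>x\<in>X. \<forall>y\<in>X. l (M_gen X r x) (A_gen X r y) = A_gen X r (sigma r x y))"

definition is_rho' ::
  "'a set \<Rightarrow> ('a \<times> 'a \<Rightarrow> 'a \<times> 'a) \<Rightarrow> ('a list set \<Rightarrow> 'a list set \<Rightarrow> 'a list set) \<Rightarrow> bool" where
  "is_rho' X r p \<longleftrightarrow>
    p \<in> monoid_antihoms (structure_monoid X r) (End_monoid (right_derived_monoid X r)) \<and>
    (\<forall>x\<in>X. \<forall>y\<in>X. p (M_gen X r x) (A'_gen X r y) = A'_gen X r (gamma r x y))"

end

theory Submission
  imports Defs
begin

text \<open>
  Everything rests on the universal property of a presentation: a map from the generators to a
  monoid that respects the defining relations extends to a unique homomorphism
  (\<open>presented_monoid_extension\<close>, \<open>presented_monoid_hom_eqI\<close>). It is used on two levels.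

  On the lower level, every \<open>\<sigma>\<^sub>t\<close> extends to an endomorphism of \<open>A(X,r)\<close>. The Yang--Baxter equation
  amounts to the identity \<open>\<sigma>\<^sub>x \<sigma>\<^sub>y = \<sigma>\<^bsub>\<sigma>\<^sub>x(y)\<^esub> \<sigma>\<^bsub>\<gamma>\<^sub>y(x)\<^esub>\<close>, its dual for \<open>\<gamma>\<close>, and one identity that
  mixes the two families. The first and the mixed one show that \<open>\<sigma>\<^sub>t\<close> takes the defining relation of \<open>A(X,r)\<close> indexed by \<open>(x, y)\<close> to the one
  indexed by \<open>(\<sigma>\<^sub>t(x), \<sigma>\<^bsub>\<gamma>\<^sub>x(t)\<^esub>(y))\<close> (\<open>sigma_A_rel\<close>). On the upper level, \<open>t \<mapsto> \<sigma>\<^sub>t\<close> extends to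
  \<open>M(X,r)\<close>: by the first identity the endomorphisms attached to the two sides of
  \<open>x \<circ> y = \<sigma>\<^sub>x(y) \<circ> \<gamma>\<^sub>y(x)\<close> agree on \<open>X\<close>, hence everywhere (\<open>ex1_presented_action\<close>).

  In the left non-degenerate case the map \<open>(x, y) \<mapsto> (\<sigma>\<^sub>t(x), \<sigma>\<^bsub>\<gamma>\<^sub>x(t)\<^esub>(y))\<close> is onto \<open>X \<times> X\<close>. Every
  defining relation is then the image of a defining relation, so the inverse permutation of \<open>\<sigma>\<^sub>t\<close>
  respects the relations as well and extends to an inverse of the endomorphism
  (\<open>letterwise_endomorphism_auto\<close>). As \<open>M(X,r)\<close> is generated by \<open>X\<close>, its whole image consists of
  automorphisms.

  The statements about \<open>A'(X,r)\<close> are the mirror images of these. An anti-homomorphism is a homomorphism into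
  the opposite monoid, so the same general lemmas serve both sides.
\<close>

section \<open>The universal property of a presentation\<close>

lemma one_presented_monoid: "\<one>\<^bsub>presented_monoid X R\<^esub> = word_class X R []"
  by (simp add: presented_monoid_def)

lemma generator_closed: "x \<in> X \<Longrightarrow> word_class X R [x] \<in> carrier (presented_monoid X R)"
  by (simp add: carrier_presented_monoid)

lemma presented_monoid_induct [consumes 1, case_names one mult]:
  assumes "Q \<in> carrier (presented_monoid X R)"
    and one: "P \<one>\<^bsub>presented_monoid X R\<^esub>"
    and mult: "\<And>x Q. x \<in> X \<Longrightarrow> Q \<in> carrier (presented_monoid X R) \<Longrightarrow> P Q \<Longrightarrow>
      P (word_class X R [x] \<otimes>\<^bsub>presented_monoid X R\<^esub> Q)"
  shows "P Q"
proof -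
  have "P (word_class X R w)" if "w \<in> lists X" for w
    using that
  proof induction
    case Nil
    then show ?case using one by (simp add: one_presented_monoid)
  next
    case (Cons x w)
    then show ?case
      using mult[of x "word_class X R w"] mult_word_class[of "[x]" X w R]
      by (simp add: carrier_presented_monoid)
  qed
  then show ?thesis using assms(1) by (auto simp: carrier_presented_monoid)
qed

lemma hom_generator_mult:
  assumes "f \<in> monoid_homs (presented_monoid X R) H" "x \<in> X" "Q \<in> carrier (presented_monoid X R)"
  shows "f (word_class X R [x] \<otimes>\<^bsub>presented_monoid X R\<^esub> Q) = f (word_class X R [x]) \<otimes>\<^bsub>H\<^esub> f Q"
  using assms generator_closed[of x X R] unfolding monoid_homs_def by (auto intro: hom_mult)

lemma presented_monoid_hom_eqI:
  assumes f: "f \<in> monoid_homs (presented_monoid X R) H"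
    and g: "g \<in> monoid_homs (presented_monoid X R) H"
    and eq: "\<And>x. x \<in> X \<Longrightarrow> f (word_class X R [x]) = g (word_class X R [x])"
  shows "f = g"
proof (rule extensionalityI[of _ "carrier (presented_monoid X R)"])
  show "f \<in> extensional (carrier (presented_monoid X R))"
    "g \<in> extensional (carrier (presented_monoid X R))"
    using f g by (auto simp: monoid_homs_def)
  fix Q assume "Q \<in> carrier (presented_monoid X R)"
  then show "f Q = g Q"
  proof (induction rule: presented_monoid_induct)
    case one
    then show ?case using f g by (simp add: monoid_homs_def)
  next
    case (mult x Q)
    then show ?case using eq hom_generator_mult[OF f] hom_generator_mult[OF g] by simp
  qed
qed

definition eval_word :: "('b, 'c) monoid_scheme \<Rightarrow> ('a \<Rightarrow> 'b) \<Rightarrow> 'a list \<Rightarrow> 'b" where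
  "eval_word H f w = foldr (\<lambda>x a. f x \<otimes>\<^bsub>H\<^esub> a) w \<one>\<^bsub>H\<^esub>"

lemma eval_word_simps [simp]:
  "eval_word H f [] = \<one>\<^bsub>H\<^esub>"
  "eval_word H f (x # w) = f x \<otimes>\<^bsub>H\<^esub> eval_word H f w"
  by (simp_all add: eval_word_def)

lemma eval_word_closed:
  assumes "Group.monoid H" "f \<in> X \<rightarrow> carrier H" "w \<in> lists X"
  shows "eval_word H f w \<in> carrier H"
  using assms(3)
proof induction
  case Nil
  show ?case using assms(1) by (simp add: monoid.one_closed)
next
  case (Cons x w)
  then show ?case using assms(1,2) by (auto intro: monoid.m_closed)
qed

lemma eval_word_append:
  assumes "Group.monoid H" "f \<in> X \<rightarrow> carrier H" "u \<in> lists X" "v \<in> lists X"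
  shows "eval_word H f (u @ v) = eval_word H f u \<otimes>\<^bsub>H\<^esub> eval_word H f v"
proof -
  interpret H: Group.monoid H by fact
  show ?thesis
    using assms(3)
  proof induction
    case Nil
    show ?case using eval_word_closed[OF assms(1,2,4)] by simp
  next
    case (Cons x u)
    then have "f x \<in> carrier H" "eval_word H f u \<in> carrier H" "eval_word H f v \<in> carrier H"
      using assms(2,4) eval_word_closed[OF assms(1,2)] by blast+
    then show ?case using Cons.IH by (simp add: H.m_assoc)
  qed
qed

lemma eval_word_cong:
  assumes H: "Group.monoid H" and f: "f \<in> X \<rightarrow> carrier H"
    and rel: "\<And>u v. (u, v) \<in> R \<Longrightarrow> u \<in> lists X \<Longrightarrow> v \<in> lists X \<Longrightarrow> eval_word H f u = eval_word H f v"
    and "(u, v) \<in> word_cong X R"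
  shows "eval_word H f u = eval_word H f v"
  using assms(4)
proof (induction rule: word_cong.induct)
  case (append u v u' v')
  then show ?case using word_cong_lists eval_word_append[OF H f] by metis
qed (use rel in auto)

lemma presented_monoid_extension:
  assumes H: "Group.monoid H" and f: "f \<in> X \<rightarrow> carrier H"
    and rel: "\<And>u v. (u, v) \<in> R \<Longrightarrow> u \<in> lists X \<Longrightarrow> v \<in> lists X \<Longrightarrow> eval_word H f u = eval_word H f v"
  shows "\<exists>h \<in> monoid_homs (presented_monoid X R) H. \<forall>x\<in>X. h (word_class X R [x]) = f x"
proof -
  interpret H: Group.monoid H by fact
  define h where
    "h = (\<lambda>Q\<in>carrier (presented_monoid X R). eval_word H f (SOME w. w \<in> Q))"
  have h: "h (word_class X R w) = eval_word H f w" if w: "w \<in> lists X" for w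
  proof -
    have "w \<in> word_class X R w"
      using w by (simp add: word_class_def word_cong.refl)
    then have "(SOME w'. w' \<in> word_class X R w) \<in> word_class X R w"
      by (rule someI)
    then have "(w, SOME w'. w' \<in> word_class X R w) \<in> word_cong X R"
      by (simp add: word_class_def)
    then show ?thesis
      using eval_word_cong[OF H f rel] w by (simp add: h_def carrier_presented_monoid)
  qed
  have "h \<in> monoid_homs (presented_monoid X R) H"
    unfolding monoid_homs_def hom_def
  proof (intro CollectI IntI conjI ballI funcsetI)
    fix P assume "P \<in> carrier (presented_monoid X R)"
    then obtain w where "w \<in> lists X" "P = word_class X R w"
      by (auto simp: carrier_presented_monoid)
    then show "h P \<in> carrier H" using eval_word_closed[OF H f] h by metis
  next
    fix P Q assume "P \<in> carrier (presented_monoid X R)" "Q \<in> carrier (presented_monoid X R)"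
    then obtain u v where "u \<in> lists X" "v \<in> lists X" "P = word_class X R u" "Q = word_class X R v"
      by (auto simp: carrier_presented_monoid)
    then show "h (P \<otimes>\<^bsub>presented_monoid X R\<^esub> Q) = h P \<otimes>\<^bsub>H\<^esub> h Q"
      using eval_word_append[OF H f] h[of "u @ v"] by (auto simp: mult_word_class h)
  next
    show "h \<in> extensional (carrier (presented_monoid X R))" by (simp add: h_def)
    show "h \<one>\<^bsub>presented_monoid X R\<^esub> = \<one>\<^bsub>H\<^esub>" by (simp add: one_presented_monoid h)
  qed
  moreover have "h (word_class X R [x]) = f x" if "x \<in> X" for x
    using that f by (simp add: h Pi_iff)
  ultimately show ?thesis by blast
qed

section \<open>Endomorphism monoids and opposite monoids\<close>

lemma monoid_homs_closed: "f \<in> monoid_homs G H \<Longrightarrow> x \<in> carrier G \<Longrightarrow> f x \<in> carrier H"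
  by (auto simp: monoid_homs_def hom_def)

lemma identity_monoid_homs:
  assumes "Group.monoid G"
  shows "(\<lambda>x\<in>carrier G. x) \<in> monoid_homs G G"
  using assms by (auto simp: monoid_homs_def hom_def monoid.m_closed monoid.one_closed)

lemma compose_monoid_homs:
  assumes "Group.monoid G" "f \<in> monoid_homs G G" "g \<in> monoid_homs G G"
  shows "compose (carrier G) f g \<in> monoid_homs G G"
proof -
  interpret Group.monoid G by fact
  show ?thesis
    using assms(2,3) by (auto simp: monoid_homs_def hom_def compose_def Pi_iff)
qed

lemma monoid_End_monoid:
  assumes "Group.monoid G"
  shows "Group.monoid (End_monoid G)"
proof (rule monoidI)
  fix f g h
  assume fgh: "f \<in> carrier (End_monoid G)" "g \<in> carrier (End_monoid G)" "h \<in> carrier (End_monoid G)"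
  then have "h \<in> carrier G \<rightarrow> carrier G"
    by (auto simp: End_monoid_def monoid_homs_def hom_def)
  then show "f \<otimes>\<^bsub>End_monoid G\<^esub> g \<otimes>\<^bsub>End_monoid G\<^esub> h = f \<otimes>\<^bsub>End_monoid G\<^esub> (g \<otimes>\<^bsub>End_monoid G\<^esub> h)"
    by (auto simp: End_monoid_def intro!: compose_assoc[symmetric])
next
  fix f assume f: "f \<in> carrier (End_monoid G)"
  then have "f \<in> carrier G \<rightarrow> carrier G" "f \<in> extensional (carrier G)"
    by (auto simp: End_monoid_def monoid_homs_def hom_def)
  then show "\<one>\<^bsub>End_monoid G\<^esub> \<otimes>\<^bsub>End_monoid G\<^esub> f = f" "f \<otimes>\<^bsub>End_monoid G\<^esub> \<one>\<^bsub>End_monoid G\<^esub> = f"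
    by (auto simp: End_monoid_def intro: Id_compose compose_Id)
qed (use assms in \<open>auto simp: End_monoid_def intro: compose_monoid_homs identity_monoid_homs\<close>)

lemma identity_auto:
  assumes "Group.monoid G"
  shows "(\<lambda>x\<in>carrier G. x) \<in> auto G"
  using identity_monoid_homs[OF assms] by (auto simp: auto_def monoid_homs_def id_Bij)

lemma compose_auto:
  assumes "Group.monoid G" "f \<in> auto G" "g \<in> auto G"
  shows "compose (carrier G) f g \<in> auto G"
  using assms compose_monoid_homs[OF assms(1)] compose_Bij[of f "carrier G" g]
  by (auto simp: auto_eq_bijective_endomorphisms Bij_def monoid_homs_def)

definition opposite_monoid :: "('a, 'c) monoid_scheme \<Rightarrow> 'a monoid" where
  "opposite_monoid H = \<lparr>carrier = carrier H, mult = (\<lambda>a b. b \<otimes>\<^bsub>H\<^esub> a), one = \<one>\<^bsub>H\<^esub>\<rparr>"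

lemma opposite_monoid_simps [simp]:
  "carrier (opposite_monoid H) = carrier H"
  "a \<otimes>\<^bsub>opposite_monoid H\<^esub> b = b \<otimes>\<^bsub>H\<^esub> a"
  "\<one>\<^bsub>opposite_monoid H\<^esub> = \<one>\<^bsub>H\<^esub>"
  by (simp_all add: opposite_monoid_def)

lemma monoid_opposite_monoid:
  assumes "Group.monoid H"
  shows "Group.monoid (opposite_monoid H)"
proof -
  interpret H: Group.monoid H by fact
  show ?thesis by (rule monoidI) (auto simp: H.m_assoc)
qed

lemma monoid_antihoms_eq_homs_opposite:
  "monoid_antihoms G H = monoid_homs G (opposite_monoid H)"
  by (auto simp: monoid_antihoms_def monoid_homs_def hom_def)

section \<open>Monoids acting on presented monoids by letterwise maps\<close>

lemma letterwise_endomorphism: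
  assumes f: "f \<in> X \<rightarrow> X"
    and rel: "\<And>u v. (u, v) \<in> S \<Longrightarrow> (map f u, map f v) \<in> S"
  shows "\<exists>h \<in> monoid_homs (presented_monoid X S) (presented_monoid X S).
    \<forall>x\<in>X. h (word_class X S [x]) = word_class X S [f x]"
proof -
  let ?A = "presented_monoid X S"
  have eval: "eval_word ?A (\<lambda>x. word_class X S [f x]) w = word_class X S (map f w)"
    if "w \<in> lists X" for w
    using that
  proof induction
    case Nil
    show ?case by (simp add: one_presented_monoid)
  next
    case (Cons x w)
    then have "map f w \<in> lists X" "[f x] \<in> lists X" using f by (auto simp: Pi_iff)
    then show ?case using Cons.IH mult_word_class[of "[f x]" X "map f w" S] by simp
  qed
  show ?thesis
  proof (rule presented_monoid_extension[OF monoid_presented_monoid])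
    show "(\<lambda>x. word_class X S [f x]) \<in> X \<rightarrow> carrier ?A"
      using f by (auto intro: generator_closed)
    fix u v assume uv: "(u, v) \<in> S" "u \<in> lists X" "v \<in> lists X"
    then have "map f u \<in> lists X" "map f v \<in> lists X" using f by (auto simp: Pi_iff)
    then show "eval_word ?A (\<lambda>x. word_class X S [f x]) u = eval_word ?A (\<lambda>x. word_class X S [f x]) v"
      using uv rel by (simp add: eval word_class_eq_iff word_cong.rel)
  qed
qed

text \<open>
  If every relation is the image under \<open>f\<close> of a relation, then the inverse permutation of the
  letters respects the relations too, and its extension inverts that of \<open>f\<close>. Bijectivity of \<open>f\<close>
  on the letters alone would not suffice: if \<open>X\<close> is infinite, \<open>f\<close> may map the relations onto a
  proper subset of themselves, and the extension may then identify words that are not congruent.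
\<close>

lemma letterwise_endomorphism_auto:
  assumes h: "h \<in> monoid_homs (presented_monoid X S) (presented_monoid X S)"
    and hf: "\<And>x. x \<in> X \<Longrightarrow> h (word_class X S [x]) = word_class X S [f x]"
    and f: "bij_betw f X X"
    and S: "S \<subseteq> lists X \<times> lists X"
    and rel: "\<And>u v. (u, v) \<in> S \<Longrightarrow> \<exists>(u', v') \<in> S. u = map f u' \<and> v = map f v'"
  shows "h \<in> auto (presented_monoid X S)"
proof -
  let ?A = "presented_monoid X S"
  let ?g = "inv_into X f"
  have g: "?g x \<in> X" "f (?g x) = x" "?g (f x) = x" "f x \<in> X" if "x \<in> X" for x
    using that f by (auto simp: bij_betw_def inv_into_into f_inv_into_f)
  have map_g: "map ?g (map f w) = w" if "w \<in> lists X" for w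
    using that by induction (auto simp: g)
  have "(map ?g u, map ?g v) \<in> S" if uv: "(u, v) \<in> S" for u v
  proof -
    obtain u' v' where "(u', v') \<in> S" "u = map f u'" "v = map f v'"
      using rel[OF uv] by blast
    moreover from this have "u' \<in> lists X" "v' \<in> lists X" using S by blast+
    ultimately show ?thesis using map_g by metis
  qed
  moreover have "?g \<in> X \<rightarrow> X" using g by blast
  ultimately obtain k where k: "k \<in> monoid_homs ?A ?A"
    and kg: "\<And>x. x \<in> X \<Longrightarrow> k (word_class X S [x]) = word_class X S [?g x]"
    using letterwise_endomorphism[of ?g X S] by blast
  have "compose (carrier ?A) h k = (\<lambda>Q\<in>carrier ?A. Q)"
    using h k by (auto intro!: presented_monoid_hom_eqI compose_monoid_homs identity_monoid_homs
        monoid_presented_monoid simp: compose_eq generator_closed hf kg g)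
  moreover have "compose (carrier ?A) k h = (\<lambda>Q\<in>carrier ?A. Q)"
    using h k by (auto intro!: presented_monoid_hom_eqI compose_monoid_homs identity_monoid_homs
        monoid_presented_monoid simp: compose_eq generator_closed hf kg g)
  ultimately have "h (k Q) = Q" "k (h Q) = Q" if "Q \<in> carrier ?A" for Q
    using that by (metis compose_eq restrict_apply')+
  then have "bij_betw h (carrier ?A) (carrier ?A)"
    by (intro bij_betw_byWitness[where f' = k]) (auto intro: monoid_homs_closed h k)
  then show ?thesis
    using h by (simp add: auto_eq_bijective_endomorphisms monoid_presented_monoid)
qed

text \<open>
  The target \<open>H\<close> will be the endomorphism monoid of \<open>presented_monoid X S\<close> or its opposite. The
  elements of \<open>H\<close> are determined by their values on the letters, which yields uniqueness and
  also makes the choice of \<open>\<phi>\<close> in the hypothesis on the relations unambiguous.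
\<close>

lemma ex1_presented_action:
  assumes H: "Group.monoid H"
    and carrier: "carrier H = monoid_homs (presented_monoid X S) (presented_monoid X S)"
    and s: "\<And>x. x \<in> X \<Longrightarrow> s x \<in> X \<rightarrow> X"
    and S: "\<And>x u v. x \<in> X \<Longrightarrow> (u, v) \<in> S \<Longrightarrow> (map (s x) u, map (s x) v) \<in> S"
    and R: "\<And>\<phi> u v. (u, v) \<in> R \<Longrightarrow> \<phi> \<in> X \<rightarrow> carrier H \<Longrightarrow>
      (\<And>x y. x \<in> X \<Longrightarrow> y \<in> X \<Longrightarrow> \<phi> x (word_class X S [y]) = word_class X S [s x y]) \<Longrightarrow>
      eval_word H \<phi> u = eval_word H \<phi> v"
  shows "\<exists>!l. l \<in> monoid_homs (presented_monoid X R) H \<and>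
    (\<forall>x\<in>X. \<forall>y\<in>X. l (word_class X R [x]) (word_class X S [y]) = word_class X S [s x y])"
proof (rule ex_ex1I)
  have "\<forall>x\<in>X. \<exists>h \<in> carrier H. \<forall>y\<in>X. h (word_class X S [y]) = word_class X S [s x y]"
    using letterwise_endomorphism[OF s S] by (simp add: carrier)
  then obtain \<phi> where \<phi>: "\<And>x. x \<in> X \<Longrightarrow> \<phi> x \<in> carrier H"
    "\<And>x y. x \<in> X \<Longrightarrow> y \<in> X \<Longrightarrow> \<phi> x (word_class X S [y]) = word_class X S [s x y]"
    by metis
  then have "\<exists>l \<in> monoid_homs (presented_monoid X R) H. \<forall>x\<in>X. l (word_class X R [x]) = \<phi> x"
    using R[of _ _ \<phi>] by (intro presented_monoid_extension[OF H]) auto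
  then show "\<exists>l. l \<in> monoid_homs (presented_monoid X R) H \<and>
    (\<forall>x\<in>X. \<forall>y\<in>X. l (word_class X R [x]) (word_class X S [y]) = word_class X S [s x y])"
    using \<phi>(2) by metis
next
  fix l l'
  assume l: "l \<in> monoid_homs (presented_monoid X R) H \<and>
    (\<forall>x\<in>X. \<forall>y\<in>X. l (word_class X R [x]) (word_class X S [y]) = word_class X S [s x y])"
    and l': "l' \<in> monoid_homs (presented_monoid X R) H \<and>
    (\<forall>x\<in>X. \<forall>y\<in>X. l' (word_class X R [x]) (word_class X S [y]) = word_class X S [s x y])"
  show "l = l'"
  proof (rule presented_monoid_hom_eqI)
    fix x assume x: "x \<in> X"
    then have "l (word_class X R [x]) \<in> carrier H" "l' (word_class X R [x]) \<in> carrier H"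
      using l l' by (auto intro: monoid_homs_closed generator_closed)
    then show "l (word_class X R [x]) = l' (word_class X R [x])"
      unfolding carrier using x l l' by (auto intro!: presented_monoid_hom_eqI)
  qed (use l l' in auto)
qed

lemma presented_monoid_hom_image_subset:
  assumes l: "l \<in> monoid_homs (presented_monoid X R) H"
    and gen: "\<And>x. x \<in> X \<Longrightarrow> l (word_class X R [x]) \<in> U"
    and one: "\<one>\<^bsub>H\<^esub> \<in> U" and mult: "\<And>a b. a \<in> U \<Longrightarrow> b \<in> U \<Longrightarrow> a \<otimes>\<^bsub>H\<^esub> b \<in> U"
  shows "l ` carrier (presented_monoid X R) \<subseteq> U"
proof
  fix a assume "a \<in> l ` carrier (presented_monoid X R)"
  then obtain Q where "Q \<in> carrier (presented_monoid X R)" "a = l Q" by blast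
  moreover from this(1) have "l Q \<in> U"
  proof (induction rule: presented_monoid_induct)
    case one
    then show ?case using l assms(3) by (simp add: monoid_homs_def)
  next
    case (mult x Q)
    then show ?case using gen assms(4) hom_generator_mult[OF l] by simp
  qed
  ultimately show "a \<in> U" by simp
qed

section \<open>The Yang--Baxter equation in components\<close>

lemma sigma_closed: "YBE_solution X r \<Longrightarrow> x \<in> X \<Longrightarrow> y \<in> X \<Longrightarrow> sigma r x y \<in> X"
  and gamma_closed: "YBE_solution X r \<Longrightarrow> x \<in> X \<Longrightarrow> y \<in> X \<Longrightarrow> gamma r y x \<in> X"
  by (force simp: YBE_solution_def sigma_def gamma_def Pi_iff)+

lemma YBE_components:
  assumes "YBE_solution X r" "x \<in> X" "y \<in> X" "z \<in> X"
  shows YBE_sigma: "sigma r (sigma r x y) (sigma r (gamma r y x) z) = sigma r x (sigma r y z)"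
    and YBE_mixed: "gamma r (sigma r (gamma r y x) z) (sigma r x y) =
      sigma r (gamma r (sigma r y z) x) (gamma r z y)"
    and YBE_gamma: "gamma r z (gamma r y x) = gamma r (gamma r z y) (gamma r (sigma r y z) x)"
proof -
  have r: "r (a, b) = (sigma r a b, gamma r b a)" for a b
    by (simp add: sigma_def gamma_def)
  have "(r_times_id r \<circ> id_times_r r \<circ> r_times_id r) (x, y, z) =
      (id_times_r r \<circ> r_times_id r \<circ> id_times_r r) (x, y, z)"
    using assms unfolding YBE_solution_def by blast
  then have "(sigma r (sigma r x y) (sigma r (gamma r y x) z),
        gamma r (sigma r (gamma r y x) z) (sigma r x y), gamma r z (gamma r y x)) =
      (sigma r x (sigma r y z), sigma r (gamma r (sigma r y z) x) (gamma r z y),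
        gamma r (gamma r z y) (gamma r (sigma r y z) x))"
    by (simp add: r_times_id_def id_times_r_def r)
  then show "sigma r (sigma r x y) (sigma r (gamma r y x) z) = sigma r x (sigma r y z)"
    "gamma r (sigma r (gamma r y x) z) (sigma r x y) =
      sigma r (gamma r (sigma r y z) x) (gamma r z y)"
    "gamma r z (gamma r y x) = gamma r (gamma r z y) (gamma r (sigma r y z) x)"
    by simp_all
qed

definition A_rel :: "('a \<times> 'a \<Rightarrow> 'a \<times> 'a) \<Rightarrow> 'a \<Rightarrow> 'a \<Rightarrow> 'a list \<times> 'a list" where
  "A_rel r x y = ([x, sigma r x y], [sigma r x y, sigma r (sigma r x y) (gamma r y x)])"

definition A'_rel :: "('a \<times> 'a \<Rightarrow> 'a \<times> 'a) \<Rightarrow> 'a \<Rightarrow> 'a \<Rightarrow> 'a list \<times> 'a list" where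
  "A'_rel r x y = ([gamma r y x, y], [gamma r (gamma r y x) (sigma r x y), gamma r y x])"

lemma A_rels_eq: "A_rels X r = {A_rel r x y | x y. x \<in> X \<and> y \<in> X}"
  and A'_rels_eq: "A'_rels X r = {A'_rel r x y | x y. x \<in> X \<and> y \<in> X}"
  by (simp_all add: A_rels_def A_rel_def A'_rels_def A'_rel_def)

text \<open>
  The new first letter \<open>\<sigma>\<^sub>t(x)\<close> is forced. The identity
  \<open>\<sigma>\<^sub>t \<sigma>\<^sub>x = \<sigma>\<^bsub>\<sigma>\<^sub>t(x)\<^esub> \<sigma>\<^bsub>\<gamma>\<^sub>x(t)\<^esub>\<close> then suggests \<open>\<sigma>\<^bsub>\<gamma>\<^sub>x(t)\<^esub>(y)\<close> as the second index.
\<close>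

lemma sigma_A_rel:
  assumes "YBE_solution X r" "t \<in> X" "x \<in> X" "y \<in> X"
  shows "map_prod (map (sigma r t)) (map (sigma r t)) (A_rel r x y) =
    A_rel r (sigma r t x) (sigma r (gamma r x t) y)"
proof -
  have "sigma r t (sigma r (sigma r x y) (gamma r y x)) =
      sigma r (sigma r t (sigma r x y)) (sigma r (gamma r (sigma r x y) t) (gamma r y x))"
    using YBE_sigma[OF assms(1,2), of "sigma r x y" "gamma r y x"] sigma_closed gamma_closed assms
    by metis
  then show ?thesis
    using YBE_sigma[OF assms] YBE_mixed[OF assms] by (simp add: A_rel_def)
qed

text \<open>The mirror image: now the last letter \<open>\<gamma>\<^sub>t(y)\<close> is forced, and it determines the first index.\<close>

lemma gamma_A'_rel:
  assumes "YBE_solution X r" "t \<in> X" "x \<in> X" "y \<in> X"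
  shows "map_prod (map (gamma r t)) (map (gamma r t)) (A'_rel r x y) =
    A'_rel r (gamma r (sigma r y t) x) (gamma r t y)"
proof -
  have "gamma r t (gamma r (gamma r y x) (sigma r x y)) =
      gamma r (gamma r t (gamma r y x)) (gamma r (sigma r (gamma r y x) t) (sigma r x y))"
    using YBE_gamma[OF assms(1), of "sigma r x y" "gamma r y x" t] sigma_closed gamma_closed assms
    by metis
  then show ?thesis
    using YBE_gamma[OF assms(1,3,4,2)] YBE_mixed[OF assms(1,3,4,2)] by (simp add: A'_rel_def)
qed

lemma sigma_respects_A_rels:
  assumes "YBE_solution X r" "t \<in> X" "(u, v) \<in> A_rels X r"
  shows "(map (sigma r t) u, map (sigma r t) v) \<in> A_rels X r"
proof -
  obtain x y where xy: "x \<in> X" "y \<in> X" "(u, v) = A_rel r x y"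
    using assms(3) by (auto simp: A_rels_eq)
  have "(map (sigma r t) u, map (sigma r t) v) = A_rel r (sigma r t x) (sigma r (gamma r x t) y)"
    using sigma_A_rel[OF assms(1,2) xy(1,2), folded xy(3)] by simp
  moreover have "sigma r t x \<in> X" "sigma r (gamma r x t) y \<in> X"
    using xy(1,2) assms(1,2) by (simp_all add: sigma_closed gamma_closed)
  ultimately show ?thesis unfolding A_rels_eq by blast
qed

lemma gamma_respects_A'_rels:
  assumes "YBE_solution X r" "t \<in> X" "(u, v) \<in> A'_rels X r"
  shows "(map (gamma r t) u, map (gamma r t) v) \<in> A'_rels X r"
proof -
  obtain x y where xy: "x \<in> X" "y \<in> X" "(u, v) = A'_rel r x y"
    using assms(3) by (auto simp: A'_rels_eq)
  have "(map (gamma r t) u, map (gamma r t) v) = A'_rel r (gamma r (sigma r y t) x) (gamma r t y)"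
    using gamma_A'_rel[OF assms(1,2) xy(1,2), folded xy(3)] by simp
  moreover have "gamma r (sigma r y t) x \<in> X" "gamma r t y \<in> X"
    using xy(1,2) assms(1,2) by (simp_all add: sigma_closed gamma_closed)
  ultimately show ?thesis unfolding A'_rels_eq by blast
qed

text \<open>
  For a relation indexed by \<open>(x, y)\<close>, one first solves \<open>\<sigma>\<^sub>t(a) = x\<close> for \<open>a\<close> and then
  \<open>\<sigma>\<^bsub>\<gamma>\<^sub>a(t)\<^esub>(b) = y\<close> for \<open>b\<close>; the second step is why all the maps \<open>\<sigma>\<close> have to be onto, not only \<open>\<sigma>\<^sub>t\<close>.
\<close>

lemma A_rels_sigma_preimage:
  assumes "YBE_solution X r" "left_nondegenerate X r" "t \<in> X" "(u, v) \<in> A_rels X r"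
  shows "\<exists>(u', v') \<in> A_rels X r. u = map (sigma r t) u' \<and> v = map (sigma r t) v'"
proof -
  have onto: "\<exists>b\<in>X. sigma r a b = c" if "a \<in> X" "c \<in> X" for a c
    using that assms(2) unfolding left_nondegenerate_def by (metis bij_betw_imp_surj_on imageE)
  obtain x y where xy: "x \<in> X" "y \<in> X" "(u, v) = A_rel r x y"
    using assms(4) by (auto simp: A_rels_eq)
  obtain x0 where x0: "x0 \<in> X" "sigma r t x0 = x"
    using onto assms(3) xy(1) by blast
  obtain y0 where y0: "y0 \<in> X" "sigma r (gamma r x0 t) y0 = y"
    using onto gamma_closed[OF assms(1,3) x0(1)] xy(2) by blast
  obtain u' v' where uv': "A_rel r x0 y0 = (u', v')" by fastforce
  then have "(u, v) = (map (sigma r t) u', map (sigma r t) v')"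
    using sigma_A_rel[OF assms(1,3) x0(1) y0(1)] x0 y0 xy by simp
  moreover have "(u', v') \<in> A_rels X r"
    unfolding A_rels_eq uv'[symmetric] using x0 y0 by blast
  ultimately show ?thesis by blast
qed

lemma A'_rels_gamma_preimage:
  assumes "YBE_solution X r" "right_nondegenerate X r" "t \<in> X" "(u, v) \<in> A'_rels X r"
  shows "\<exists>(u', v') \<in> A'_rels X r. u = map (gamma r t) u' \<and> v = map (gamma r t) v'"
proof -
  have onto: "\<exists>b\<in>X. gamma r a b = c" if "a \<in> X" "c \<in> X" for a c
    using that assms(2) unfolding right_nondegenerate_def by (metis bij_betw_imp_surj_on imageE)
  obtain x y where xy: "x \<in> X" "y \<in> X" "(u, v) = A'_rel r x y"
    using assms(4) by (auto simp: A'_rels_eq)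
  obtain y0 where y0: "y0 \<in> X" "gamma r t y0 = y"
    using onto assms(3) xy(2) by blast
  obtain x0 where x0: "x0 \<in> X" "gamma r (sigma r y0 t) x0 = x"
    using onto sigma_closed[OF assms(1) y0(1) assms(3)] xy(1) by blast
  obtain u' v' where uv': "A'_rel r x0 y0 = (u', v')" by fastforce
  then have "(u, v) = (map (gamma r t) u', map (gamma r t) v')"
    using gamma_A'_rel[OF assms(1,3) x0(1) y0(1)] x0 y0 xy by simp
  moreover have "(u', v') \<in> A'_rels X r"
    unfolding A'_rels_eq uv'[symmetric] using x0 y0 by blast
  ultimately show ?thesis by blast
qed

lemma A_rels_lists: "YBE_solution X r \<Longrightarrow> A_rels X r \<subseteq> lists X \<times> lists X"
  and A'_rels_lists: "YBE_solution X r \<Longrightarrow> A'_rels X r \<subseteq> lists X \<times> lists X"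
  by (auto simp: A_rels_def A'_rels_def sigma_closed gamma_closed)

section \<open>The actions of the structure monoid\<close>

lemma ex1_lambda':
  assumes r: "YBE_solution X r"
  shows "\<exists>!l. is_lambda' X r l"
  unfolding is_lambda'_def
proof (rule ex1_presented_action)
  let ?A = "left_derived_monoid X r"
  show E: "Group.monoid (End_monoid ?A)"
    by (intro monoid_End_monoid monoid_presented_monoid)
  show "carrier (End_monoid ?A) = monoid_homs ?A ?A" by (simp add: End_monoid_def)
  show "sigma r x \<in> X \<rightarrow> X" if "x \<in> X" for x using sigma_closed[OF r that] by blast
  show "(map (sigma r x) u, map (sigma r x) v) \<in> A_rels X r"
    if "x \<in> X" "(u, v) \<in> A_rels X r" for x u v
    using sigma_respects_A_rels[OF r that] .
  fix \<phi> u v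
  assume "(u, v) \<in> M_rels X r" and \<phi>: "\<phi> \<in> X \<rightarrow> carrier (End_monoid ?A)"
    and gen: "\<And>x y. x \<in> X \<Longrightarrow> y \<in> X \<Longrightarrow> \<phi> x (A_gen X r y) = A_gen X r (sigma r x y)"
  then obtain x y where uv: "u = [x, y]" "v = [sigma r x y, gamma r y x]" and xy: "x \<in> X" "y \<in> X"
    by (auto simp: M_rels_def)
  have hom: "\<phi> a \<in> monoid_homs ?A ?A" if "a \<in> X" for a
    using \<phi> that by (auto simp: End_monoid_def)
  have X: "sigma r x y \<in> X" "gamma r y x \<in> X"
    using xy by (simp_all add: sigma_closed[OF r] gamma_closed[OF r])
  have "compose (carrier ?A) (\<phi> x) (\<phi> y) =
      compose (carrier ?A) (\<phi> (sigma r x y)) (\<phi> (gamma r y x))"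
  proof (rule presented_monoid_hom_eqI)
    fix z assume "z \<in> X"
    then show "compose (carrier ?A) (\<phi> x) (\<phi> y) (A_gen X r z) =
        compose (carrier ?A) (\<phi> (sigma r x y)) (\<phi> (gamma r y x)) (A_gen X r z)"
      using xy X YBE_sigma[OF r xy] sigma_closed[OF r]
      by (simp add: compose_eq generator_closed gen)
  qed (use hom xy X in \<open>auto intro: compose_monoid_homs monoid_presented_monoid\<close>)
  moreover have "\<phi> a \<in> carrier (End_monoid ?A)" if "a \<in> X" for a using \<phi> that by blast
  ultimately show "eval_word (End_monoid ?A) \<phi> u = eval_word (End_monoid ?A) \<phi> v"
    using xy X by (simp add: uv monoid.r_one[OF E]) (simp add: End_monoid_def)
qed

lemma ex1_rho':
  assumes r: "YBE_solution X r"
  shows "\<exists>!p. is_rho' X r p"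
  unfolding is_rho'_def monoid_antihoms_eq_homs_opposite
proof (rule ex1_presented_action)
  let ?A = "right_derived_monoid X r"
  have E: "Group.monoid (End_monoid ?A)"
    by (intro monoid_End_monoid monoid_presented_monoid)
  show "Group.monoid (opposite_monoid (End_monoid ?A))"
    by (rule monoid_opposite_monoid[OF E])
  show "carrier (opposite_monoid (End_monoid ?A)) = monoid_homs ?A ?A" by (simp add: End_monoid_def)
  show "gamma r x \<in> X \<rightarrow> X" if "x \<in> X" for x using gamma_closed[OF r _ that] by blast
  show "(map (gamma r x) u, map (gamma r x) v) \<in> A'_rels X r"
    if "x \<in> X" "(u, v) \<in> A'_rels X r" for x u v
    using gamma_respects_A'_rels[OF r that] .
  fix \<phi> u v
  assume "(u, v) \<in> M_rels X r" and \<phi>: "\<phi> \<in> X \<rightarrow> carrier (opposite_monoid (End_monoid ?A))"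
    and gen: "\<And>x y. x \<in> X \<Longrightarrow> y \<in> X \<Longrightarrow> \<phi> x (A'_gen X r y) = A'_gen X r (gamma r x y)"
  then obtain x y where uv: "u = [x, y]" "v = [sigma r x y, gamma r y x]" and xy: "x \<in> X" "y \<in> X"
    by (auto simp: M_rels_def)
  have hom: "\<phi> a \<in> monoid_homs ?A ?A" if "a \<in> X" for a
    using \<phi> that by (auto simp: End_monoid_def)
  have X: "sigma r x y \<in> X" "gamma r y x \<in> X"
    using xy by (simp_all add: sigma_closed[OF r] gamma_closed[OF r])
  have "compose (carrier ?A) (\<phi> y) (\<phi> x) =
      compose (carrier ?A) (\<phi> (gamma r y x)) (\<phi> (sigma r x y))"
  proof (rule presented_monoid_hom_eqI)
    fix z assume z: "z \<in> X"
    then show "compose (carrier ?A) (\<phi> y) (\<phi> x) (A'_gen X r z) =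
        compose (carrier ?A) (\<phi> (gamma r y x)) (\<phi> (sigma r x y)) (A'_gen X r z)"
      using xy X YBE_gamma[OF r z xy] gamma_closed[OF r]
      by (simp add: compose_eq generator_closed gen)
  qed (use hom xy X in \<open>auto intro: compose_monoid_homs monoid_presented_monoid\<close>)
  moreover have "\<phi> a \<in> carrier (End_monoid ?A)" if "a \<in> X" for a using \<phi> that by auto
  ultimately show "eval_word (opposite_monoid (End_monoid ?A)) \<phi> u =
      eval_word (opposite_monoid (End_monoid ?A)) \<phi> v"
    using xy X by (simp add: uv monoid.l_one[OF E]) (simp add: End_monoid_def)
qed

lemma lambda'_image_auto:
  assumes r: "YBE_solution X r" and nd: "left_nondegenerate X r" and l: "is_lambda' X r l"
  shows "l ` carrier (structure_monoid X r) \<subseteq> auto (left_derived_monoid X r)"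
proof (rule presented_monoid_hom_image_subset)
  let ?A = "left_derived_monoid X r"
  show hom: "l \<in> monoid_homs (structure_monoid X r) (End_monoid ?A)"
    using l by (simp add: is_lambda'_def)
  fix x assume x: "x \<in> X"
  show "l (M_gen X r x) \<in> auto ?A"
  proof (rule letterwise_endomorphism_auto)
    show "l (M_gen X r x) \<in> monoid_homs ?A ?A"
      using monoid_homs_closed[OF hom generator_closed[OF x]] by (simp add: End_monoid_def)
    show "l (M_gen X r x) (A_gen X r y) = A_gen X r (sigma r x y)" if "y \<in> X" for y
      using l x that by (simp add: is_lambda'_def)
    show "bij_betw (sigma r x) X X" using nd x by (simp add: left_nondegenerate_def)
  qed (use A_rels_lists[OF r] A_rels_sigma_preimage[OF r nd x] in auto)
qed (auto simp: End_monoid_def intro: identity_auto compose_auto monoid_presented_monoid)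

lemma rho'_image_auto:
  assumes r: "YBE_solution X r" and nd: "right_nondegenerate X r" and p: "is_rho' X r p"
  shows "p ` carrier (structure_monoid X r) \<subseteq> auto (right_derived_monoid X r)"
proof (rule presented_monoid_hom_image_subset)
  let ?A = "right_derived_monoid X r"
  show hom: "p \<in> monoid_homs (structure_monoid X r) (opposite_monoid (End_monoid ?A))"
    using p by (simp add: is_rho'_def monoid_antihoms_eq_homs_opposite)
  fix x assume x: "x \<in> X"
  show "p (M_gen X r x) \<in> auto ?A"
  proof (rule letterwise_endomorphism_auto)
    show "p (M_gen X r x) \<in> monoid_homs ?A ?A"
      using monoid_homs_closed[OF hom generator_closed[OF x]] by (simp add: End_monoid_def)
    show "p (M_gen X r x) (A'_gen X r y) = A'_gen X r (gamma r x y)" if "y \<in> X" for y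
      using p x that by (simp add: is_rho'_def)
    show "bij_betw (gamma r x) X X" using nd x by (simp add: right_nondegenerate_def)
  qed (use A'_rels_lists[OF r] A'_rels_gamma_preimage[OF r nd x] in auto)
qed (auto simp: End_monoid_def intro: identity_auto compose_auto monoid_presented_monoid)

theorem proposition3p1:
  fixes X :: "'a set" and r :: "'a \<times> 'a \<Rightarrow> 'a \<times> 'a"
  assumes "YBE_solution X r"
  shows "(\<exists>!l. is_lambda' X r l) \<and>
    (\<exists>!p. is_rho' X r p) \<and>
    (left_nondegenerate X r \<longrightarrow>
      (\<forall>l. is_lambda' X r l \<longrightarrow>
        l ` carrier (structure_monoid X r) \<subseteq> auto (left_derived_monoid X r))) \<and>
    (right_nondegenerate X r \<longrightarrow>
      (\<forall>p. is_rho' X r p \<longrightarrow>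
        p ` carrier (structure_monoid X r) \<subseteq> auto (right_derived_monoid X r)))"
  using ex1_lambda'[OF assms] ex1_rho'[OF assms] lambda'_image_auto[OF assms]
    rho'_image_auto[OF assms]
  by blast

end
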